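(* Every distributive skew lattice is categorical.
   Context: A skew lattice is an algebra $(S;\lor,\land)$ where $\lor,\land$ are associative idempotent binary operations satisfying $x\land(x\lor y)=x=(y\lor x)\land x$ and $x\lor(x\land y)=x=(y\land x)\lor x$. It is distributive if it satisfies both identities $x\land(y\lor z)\land x=(x\land y\land x)\lor(x\land z\land x)$ and $x\lor(y\land z)\lor x=(x\lor y\lor x)\land(x\lor z\lor x)$. The natural preorder is $x\succeq y$ iff $x\lor y\lor x=x$ (equivalently $y\land x\land y=y$), and $x\,\mathcal{D}\,y$ means $x\succeq y\succeq x$; $\mathcal{D}$ is a congruence and $\mathbf{S}/\mathcal{D}$ is a lattice. The natural partial order is $x\ge y$ iff $x\lor y=x=y\lor x$ (equivalently $x\land y=y=y\land x$); $x>y$ means $x\ge y$, $x\ne y$. For $\mathcal{D}$-classes $A>B$ (in the order of the lattice $\mathbf{S}/\mathcal{D}$), an $A$-coset in $B$ is a set $A\land b\land A=\{a\land b\land a' : a,a'\in A\}$ with $b\in B$; a $B$-coset in $A$ is a set $B\lor a\lor B=\{b\lor a\lor b' : b,b'\in B\}$ with $a\in A$. For a $B$-coset $X$ in $A$ and an $A$-coset $Y$ in $B$, the coset bijection $X\to Y$ is the bijection $\{(a,b)\in X\times Y : a>b\}$; it is regarded as a partial bijection $A\to B$. A skew lattice is categorical if for every three-term chain $A>B>C$ of its $\mathcal{D}$-classes and all coset bijections $\varphi:A\to B$ and $\psi:B\to C$, the composite partial bijection $\psi\circ\varphi$, if nonempty, is a coset bijection from $A$ to $C$. *)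

theory Defs
  imports Main
begin

locale skew_lattice =
  fixes join :: "'a \<Rightarrow> 'a \<Rightarrow> 'a" (infixl "\<squnion>" 65)
    and meet :: "'a \<Rightarrow> 'a \<Rightarrow> 'a" (infixl "\<sqinter>" 70)
  assumes join_assoc: "(x \<squnion> y) \<squnion> z = x \<squnion> (y \<squnion> z)"
    and meet_assoc: "(x \<sqinter> y) \<sqinter> z = x \<sqinter> (y \<sqinter> z)"
    and join_idem: "x \<squnion> x = x"
    and meet_idem: "x \<sqinter> x = x"
    and meet_join_absorb: "x \<sqinter> (x \<squnion> y) = x"
    and join_meet_absorb_right: "(y \<squnion> x) \<sqinter> x = x"
    and join_meet_absorb: "x \<squnion> (x \<sqinter> y) = x"
    and meet_join_absorb_right: "(y \<sqinter> x) \<squnion> x = x"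
begin

definition nat_preorder :: "'a \<Rightarrow> 'a \<Rightarrow> bool" (infix "\<succeq>" 50) where
  "x \<succeq> y \<longleftrightarrow> x \<squnion> y \<squnion> x = x"

definition D_rel :: "('a \<times> 'a) set" where
  "D_rel = {(x, y). x \<succeq> y \<and> y \<succeq> x}"

definition nat_ge :: "'a \<Rightarrow> 'a \<Rightarrow> bool" (infix "\<sqsupseteq>" 50) where
  "x \<sqsupseteq> y \<longleftrightarrow> x \<squnion> y = x \<and> y \<squnion> x = x"

definition nat_gt :: "'a \<Rightarrow> 'a \<Rightarrow> bool" (infix "\<sqsupset>" 50) where
  "x \<sqsupset> y \<longleftrightarrow> x \<sqsupseteq> y \<and> x \<noteq> y"

definition D_classes :: "'a set set" where
  "D_classes = UNIV // D_rel"

text \<open>The meet operation of the quotient lattice. Since \<^const>\<open>D_rel\<close> is a congruence,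
  all members of the union coincide when \<open>A\<close> and \<open>B\<close> are classes.\<close>
definition D_meet :: "'a set \<Rightarrow> 'a set \<Rightarrow> 'a set" where
  "D_meet A B = (\<Union>a\<in>A. \<Union>b\<in>B. D_rel `` {a \<sqinter> b})"

definition D_gt :: "'a set \<Rightarrow> 'a set \<Rightarrow> bool" where
  "D_gt A B \<longleftrightarrow> D_meet A B = B \<and> A \<noteq> B"

definition lower_cosets :: "'a set \<Rightarrow> 'a set \<Rightarrow> 'a set set" where
  "lower_cosets A B = {{a \<sqinter> b \<sqinter> a' | a a'. a \<in> A \<and> a' \<in> A} | b. b \<in> B}"

definition upper_cosets :: "'a set \<Rightarrow> 'a set \<Rightarrow> 'a set set" where
  "upper_cosets A B = {{b \<squnion> a \<squnion> b' | b b'. b \<in> B \<and> b' \<in> B} | a. a \<in> A}"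

text \<open>Partial bijections are represented by their graphs, so the composite of \<open>\<phi>\<close> followed
  by \<open>\<psi>\<close> is the relational composition \<open>\<phi> O \<psi>\<close>. For \<open>A\<close> above \<open>B\<close>, \<open>upper_cosets A B\<close> are
  the \<open>B\<close>-cosets in \<open>A\<close> and \<open>lower_cosets A B\<close> are the \<open>A\<close>-cosets in \<open>B\<close>.\<close>
definition coset_bijections :: "'a set \<Rightarrow> 'a set \<Rightarrow> ('a \<times> 'a) set set" where
  "coset_bijections A B =
     {{(a, b) \<in> X \<times> Y. a \<sqsupset> b} | X Y. X \<in> upper_cosets A B \<and> Y \<in> lower_cosets A B}"

definition categorical :: bool where
  "categorical \<longleftrightarrow>
     (\<forall>A\<in>D_classes. \<forall>B\<in>D_classes. \<forall>C\<in>D_classes. D_gt A B \<longrightarrow> D_gt B C \<longrightarrow>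
        (\<forall>\<phi>\<in>coset_bijections A B. \<forall>\<psi>\<in>coset_bijections B C.
           \<phi> O \<psi> \<noteq> {} \<longrightarrow> \<phi> O \<psi> \<in> coset_bijections A C))"

end

locale distributive_skew_lattice = skew_lattice +
  assumes meet_distrib: "x \<sqinter> (y \<squnion> z) \<sqinter> x = (x \<sqinter> y \<sqinter> x) \<squnion> (x \<sqinter> z \<sqinter> x)"
    and join_distrib: "x \<squnion> (y \<sqinter> z) \<squnion> x = (x \<squnion> y \<squnion> x) \<sqinter> (x \<squnion> z \<squnion> x)"

end

theory Submission imports Defs begin

text \<open>
  Distributivity gives, for \<open>x \<ge> y\<close>, the identity
  \<open>x \<and> (z \<or> y \<or> z) \<and> x = (x \<and> z \<and> x) \<or> y \<or> (x \<and> z \<and> x)\<close> and its order dual.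
  Take classes \<open>A > B > C\<close> and a chain \<open>a > b > c\<close> in the composite \<open>\<psi> \<circ> \<phi>\<close>.
  For a second chain \<open>a' > b' > c'\<close> in the composite, \<open>a \<and> b' \<and> a = b\<close>, and the identity
  turns this into \<open>b \<ge> a \<and> c' \<and> a\<close>; uniqueness in the \<open>B\<close>-coset of \<open>c\<close> then yields
  \<open>a \<and> c' \<and> a = c\<close>, so \<open>c'\<close> lies in the \<open>A\<close>-coset of \<open>c\<close>, and dually for \<open>a'\<close>.
  Conversely, if \<open>a' > c'\<close> with \<open>a'\<close> in the \<open>C\<close>-coset of \<open>a\<close> and \<open>c'\<close> in the \<open>A\<close>-coset of
  \<open>c\<close>, then \<open>a' \<and> b \<and> a' = c' \<or> b \<or> c'\<close> is the required element between them.
\<close>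

section \<open>Order, preorder and duality in a skew lattice\<close>

context skew_lattice
begin

lemma skew_lattice_dual: "skew_lattice (\<sqinter>) (\<squnion>)"
  by unfold_locales
    (simp_all add: join_assoc meet_assoc join_idem meet_idem meet_join_absorb
      join_meet_absorb_right join_meet_absorb meet_join_absorb_right)

lemma nat_ge_iff_meet: "x \<sqsupseteq> y \<longleftrightarrow> x \<sqinter> y = y \<and> y \<sqinter> x = y"
  unfolding nat_ge_def
  by (metis meet_join_absorb join_meet_absorb_right join_meet_absorb meet_join_absorb_right)

lemma nat_ge_dual: "skew_lattice.nat_ge (\<sqinter>) x y \<longleftrightarrow> y \<sqsupseteq> x"
  by (auto simp: nat_ge_iff_meet skew_lattice.nat_ge_def[OF skew_lattice_dual])

lemma nat_ge_meet_sandwich: "x \<sqinter> y \<sqinter> x = y \<longleftrightarrow> x \<sqsupseteq> y"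
  unfolding nat_ge_iff_meet by (metis meet_assoc meet_idem)

lemma nat_ge_join_sandwich: "y \<squnion> x \<squnion> y = x \<longleftrightarrow> x \<sqsupseteq> y"
  unfolding nat_ge_def by (metis join_assoc join_idem)

lemma nat_ge_meetD: "x \<sqsupseteq> y \<Longrightarrow> x \<sqinter> y \<sqinter> x = y"
  by (simp add: nat_ge_meet_sandwich)

lemma nat_ge_joinD: "x \<sqsupseteq> y \<Longrightarrow> y \<squnion> x \<squnion> y = x"
  by (simp add: nat_ge_join_sandwich)

lemma nat_ge_meet_meet: "x \<sqsupseteq> x \<sqinter> y \<sqinter> x"
  by (metis nat_ge_iff_meet meet_assoc meet_idem)

lemma nat_ge_join_join: "x \<squnion> y \<squnion> x \<sqsupseteq> x"
  by (metis nat_ge_def join_assoc join_idem)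

lemma nat_ge_trans: "x \<sqsupseteq> y \<Longrightarrow> y \<sqsupseteq> z \<Longrightarrow> x \<sqsupseteq> z"
  unfolding nat_ge_def by (metis join_assoc)

text \<open>Its order dual is the converse, so the preorder can be read off either operation;
  absorption exhibits \<open>y\<close> as a meet starting with
  \<open>y \<sqinter> x\<close>.\<close>

lemma meet_sandwich_of_join_sandwich:
  assumes "x \<squnion> y \<squnion> x = x"
  shows "y \<sqinter> x \<sqinter> y = y"
proof -
  have "x \<sqinter> (y \<squnion> x) = y \<squnion> x"
    by (metis assms join_assoc join_meet_absorb_right)
  then have "y \<sqinter> x \<sqinter> (y \<squnion> x) = y"
    by (simp add: meet_assoc meet_join_absorb)
  then show ?thesis
    by (metis meet_assoc meet_idem)
qed

lemma nat_preorder_iff_meet: "x \<succeq> y \<longleftrightarrow> y \<sqinter> x \<sqinter> y = y"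
  unfolding nat_preorder_def
  using meet_sandwich_of_join_sandwich
    skew_lattice.meet_sandwich_of_join_sandwich[OF skew_lattice_dual] by blast

lemma nat_preorder_trans:
  assumes "x \<succeq> y" "y \<succeq> z"
  shows "x \<succeq> z"
proof -
  have x: "x = x \<squnion> y \<squnion> x" and y: "y = y \<squnion> z \<squnion> y"
    using assms by (simp_all add: nat_preorder_def)
  define p q where "p = x \<squnion> y" and "q = y \<squnion> x"
  \<comment> \<open>Collapsing the repeated \<open>p \<squnion> z\<close> gives
    \<open>p \<squnion> t = x\<close>, while \<open>x \<squnion> z \<squnion> x\<close> spells out
    \<open>p \<squnion> t \<squnion> t\<close>; idempotence of \<open>t\<close> identifies the
    two.\<close>
  define t where "t = z \<squnion> p \<squnion> z \<squnion> q"
  have pzq: "x = p \<squnion> z \<squnion> q"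
    using x y by (metis p_def q_def join_assoc)
  have "p \<squnion> t = x"
    unfolding t_def pzq by (metis join_assoc join_idem)
  moreover have "x \<squnion> z \<squnion> x = p \<squnion> t \<squnion> t"
    using \<open>p \<squnion> t = x\<close> pzq by (metis t_def join_assoc)
  ultimately show ?thesis
    by (metis nat_preorder_def join_assoc join_idem)
qed

lemma equiv_D_rel: "equiv UNIV D_rel"
  by (rule equivI)
    (auto simp: refl_on_def sym_def trans_def D_rel_def nat_preorder_def[of x x for x] join_idem
      intro: nat_preorder_trans)

end

section \<open>Cosets between two comparable classes\<close>

locale class_pair = skew_lattice +
  fixes A B :: "'a set"
  assumes upper_meet_closed: "a \<in> A \<Longrightarrow> a' \<in> A \<Longrightarrow> a \<sqinter> a' \<in> A"
    and lower_join_closed: "b \<in> B \<Longrightarrow> b' \<in> B \<Longrightarrow> b \<squnion> b' \<in> B"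
    and upper_meet_rect: "a \<in> A \<Longrightarrow> a' \<in> A \<Longrightarrow> a \<sqinter> a' \<sqinter> a = a"
    and lower_join_rect: "b \<in> B \<Longrightarrow> b' \<in> B \<Longrightarrow> b \<squnion> b' \<squnion> b = b"
    and meet_lower: "a \<in> A \<Longrightarrow> b \<in> B \<Longrightarrow> a \<sqinter> b \<in> B" "a \<in> A \<Longrightarrow> b \<in> B \<Longrightarrow> b \<sqinter> a \<in> B"
    and join_upper: "a \<in> A \<Longrightarrow> b \<in> B \<Longrightarrow> a \<squnion> b \<in> A" "a \<in> A \<Longrightarrow> b \<in> B \<Longrightarrow> b \<squnion> a \<in> A"
begin

text \<open>The locale axioms come in dual pairs, so each fact about A-cosets in B also yields one
  about B-cosets in A.\<close>

lemma class_pair_dual: "class_pair (\<sqinter>) (\<squnion>) B A"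
  by (intro class_pair.intro skew_lattice_dual class_pair_axioms.intro)
    (blast intro: upper_meet_closed lower_join_closed
      upper_meet_rect lower_join_rect meet_lower join_upper)+

text \<open>A is a rectangular band under meet: once \<open>z\<close> is expanded to
  \<open>z \<sqinter> x \<sqinter> z\<close>, the two copies of \<open>x\<close> absorb
  \<open>y \<sqinter> z\<close>.\<close>

lemma upper_meet_mid:
  assumes "x \<in> A" "y \<in> A" "z \<in> A"
  shows "x \<sqinter> y \<sqinter> z = x \<sqinter> z"
proof -
  have "x \<sqinter> y \<sqinter> z = x \<sqinter> y \<sqinter> (z \<sqinter> x \<sqinter> z)"
    using assms by (simp add: upper_meet_rect)
  also have "\<dots> = (x \<sqinter> (y \<sqinter> z) \<sqinter> x) \<sqinter> z"
    by (simp add: meet_assoc)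
  also have "\<dots> = x \<sqinter> z"
    using assms upper_meet_closed upper_meet_rect by presburger
  finally show ?thesis .
qed

definition coset :: "'a \<Rightarrow> 'a set" where
  "coset b = {a \<sqinter> b \<sqinter> a' | a a'. a \<in> A \<and> a' \<in> A}"

text \<open>Absorption factors \<open>b\<close> through \<open>y \<squnion> b\<close>, which lies in
  A, so the rectangular law of A removes \<open>y\<close>.\<close>

lemma upper_meet_absorb_left:
  assumes "x \<in> A" "y \<in> A" "b \<in> B"
  shows "x \<sqinter> y \<sqinter> b = x \<sqinter> b"
proof -
  have "y \<squnion> b \<in> A" "(y \<squnion> b) \<sqinter> b = b"
    using assms by (simp_all add: join_upper join_meet_absorb_right)
  then show ?thesis
    using upper_meet_mid[of x y "y \<squnion> b"] assms by (metis meet_assoc)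
qed

lemma upper_meet_absorb_right:
  assumes "x \<in> A" "y \<in> A" "b \<in> B"
  shows "b \<sqinter> x \<sqinter> y = b \<sqinter> y"
proof -
  have "b \<squnion> x \<in> A" "b \<sqinter> (b \<squnion> x) = b"
    using assms by (simp_all add: join_upper meet_join_absorb)
  then show ?thesis
    using upper_meet_mid[of "b \<squnion> x" x y] assms by (metis meet_assoc)
qed

lemma coset_subset: "b \<in> B \<Longrightarrow> coset b \<subseteq> B"
  by (auto simp: coset_def meet_lower)

text \<open>The projection \<open>a \<sqinter> b \<sqinter> a\<close> is an invariant of the coset,
  since \<open>a\<close> swallows the outer factors from A. By \<open>coset_eqI\<close> it also
  separates cosets.\<close>

lemma coset_meet_eq:
  assumes "a \<in> A" "b \<in> B" "b' \<in> coset b"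
  shows "a \<sqinter> b' \<sqinter> a = a \<sqinter> b \<sqinter> a"
proof -
  obtain x y where xy: "x \<in> A" "y \<in> A" "b' = x \<sqinter> b \<sqinter> y"
    using assms(3) by (auto simp: coset_def)
  have "a \<sqinter> b' \<sqinter> a = (a \<sqinter> x \<sqinter> b) \<sqinter> y \<sqinter> a"
    by (simp add: xy meet_assoc)
  also have "\<dots> = a \<sqinter> (b \<sqinter> y \<sqinter> a)"
    using assms xy by (metis upper_meet_absorb_left meet_assoc)
  also have "\<dots> = a \<sqinter> b \<sqinter> a"
    using assms xy by (metis upper_meet_absorb_right meet_assoc)
  finally show ?thesis .
qed

lemma coset_eq_meet:
  assumes "a \<in> A" "b \<in> B"
  shows "coset b = coset (a \<sqinter> b \<sqinter> a)"
proof -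
  have "x \<sqinter> (a \<sqinter> b \<sqinter> a) \<sqinter> y = x \<sqinter> b \<sqinter> y" if "x \<in> A" "y \<in> A" for x y
  proof -
    have "x \<sqinter> (a \<sqinter> b \<sqinter> a) \<sqinter> y = (x \<sqinter> a \<sqinter> b) \<sqinter> a \<sqinter> y"
      by (simp add: meet_assoc)
    also have "\<dots> = x \<sqinter> (b \<sqinter> a \<sqinter> y)"
      using assms that by (metis upper_meet_absorb_left meet_assoc)
    also have "\<dots> = x \<sqinter> b \<sqinter> y"
      using assms that by (metis upper_meet_absorb_right meet_assoc)
    finally show ?thesis .
  qed
  then show ?thesis
    unfolding coset_def by (intro Collect_cong) metis
qed

lemma coset_eqI:
  assumes "a \<in> A" "b \<in> B" "b' \<in> B" "a \<sqinter> b' \<sqinter> a = a \<sqinter> b \<sqinter> a"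
  shows "coset b' = coset b"
  using assms coset_eq_meet by metis

lemma coset_eq: "a \<in> A \<Longrightarrow> b \<in> B \<Longrightarrow> b' \<in> coset b \<Longrightarrow> coset b' = coset b"
  using coset_eqI coset_meet_eq coset_subset by blast

lemma coset_refl:
  assumes "a \<in> A" "b \<in> B"
  shows "b \<in> coset b"
proof -
  \<comment> \<open>An element of A above \<open>b\<close>, so that \<open>b\<close> is its own
    projection under it.\<close>
  let ?u = "b \<squnion> a \<squnion> b"
  have "?u \<in> A" "?u \<sqsupseteq> b"
    using assms by (simp_all add: join_upper nat_ge_join_join)
  then have "b = ?u \<sqinter> b \<sqinter> ?u"
    by (metis nat_ge_meet_sandwich)
  with \<open>?u \<in> A\<close> show ?thesis
    unfolding coset_def by blast
qed

text \<open>Uniqueness behind the coset bijections: an element below \<open>a\<close> equals its own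
  projection, which is the invariant of the coset.\<close>

lemma coset_ge_eq:
  assumes "a \<in> A" "b \<in> B" "b' \<in> coset b" "a \<sqsupseteq> b'"
  shows "b' = a \<sqinter> b \<sqinter> a"
  using coset_meet_eq[OF assms(1-3)] assms(4) by (metis nat_ge_meet_sandwich)

end

section \<open>The two consequences of distributivity\<close>

context distributive_skew_lattice
begin

text \<open>Distributivity enters the coset arguments only through this identity and its dual; the
  hypothesis fixes the middle term \<open>x \<sqinter> y \<sqinter> x\<close> as
  \<open>y\<close>.\<close>

lemma meet_join_sandwich:
  assumes "x \<sqsupseteq> y"
  shows "x \<sqinter> (z \<squnion> y \<squnion> z) \<sqinter> x = (x \<sqinter> z \<sqinter> x) \<squnion> y \<squnion> (x \<sqinter> z \<sqinter> x)"
  using assms by (simp add: meet_distrib nat_ge_meetD)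

lemma join_meet_sandwich:
  assumes "x \<sqsupseteq> y"
  shows "y \<squnion> (z \<sqinter> x \<sqinter> z) \<squnion> y = (y \<squnion> z \<squnion> y) \<sqinter> x \<sqinter> (y \<squnion> z \<squnion> y)"
  using assms by (simp add: join_distrib nat_ge_joinD)

end

section \<open>Composing coset bijections along three classes\<close>

locale distributive_class_chain = distributive_skew_lattice +
  fixes A B C :: "'a set"
  assumes AB: "class_pair (\<squnion>) (\<sqinter>) A B"
    and BC: "class_pair (\<squnion>) (\<sqinter>) B C"
    and AC: "class_pair (\<squnion>) (\<sqinter>) A C"
begin

text \<open>In the order dual, \<open>BA.coset a\<close> is the \<open>B\<close>-coset of \<open>a\<close> in \<open>A\<close>; similarly for \<open>CB\<close>, \<open>CA\<close>.\<close>
sublocale AB: class_pair "(\<squnion>)" "(\<sqinter>)" A B by (fact AB)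
sublocale BC: class_pair "(\<squnion>)" "(\<sqinter>)" B C by (fact BC)
sublocale AC: class_pair "(\<squnion>)" "(\<sqinter>)" A C by (fact AC)
sublocale BA: class_pair "(\<sqinter>)" "(\<squnion>)" B A by (rule AB.class_pair_dual)
sublocale CB: class_pair "(\<sqinter>)" "(\<squnion>)" C B by (rule BC.class_pair_dual)
sublocale CA: class_pair "(\<sqinter>)" "(\<squnion>)" C A by (rule AC.class_pair_dual)

lemma distributive_class_chain_dual: "distributive_class_chain (\<sqinter>) (\<squnion>) C B A"
  by unfold_locales (rule meet_distrib join_distrib)+

text \<open>Controls the bottom of a second chain in the composite; read in the dual chain C, B, A
  it controls the top.\<close>

lemma coset_bottom:
  assumes "a \<in> A" "b \<in> B" "c \<in> C" "a \<sqsupseteq> b" "b \<sqsupseteq> c"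
    and "b' \<in> B" "c' \<in> C" "b' \<sqsupseteq> c'"
    and "b' \<in> AB.coset b" "b' \<in> CB.coset b" "c' \<in> BC.coset c"
  shows "a \<sqinter> c' \<sqinter> a = c"
proof -
  let ?u = "a \<sqinter> c' \<sqinter> a"
  \<comment> \<open>\<open>b'\<close> is the only element above \<open>c'\<close> in the C-coset of
    \<open>b\<close>.\<close>
  have b': "b' = c' \<squnion> b \<squnion> c'"
    using CB.coset_ge_eq[of c' b b'] assms by (simp add: nat_ge_dual)
  have "b = a \<sqinter> b' \<sqinter> a"
    using AB.coset_meet_eq[of a b b'] assms by (simp add: nat_ge_meetD)
  also have "\<dots> = ?u \<squnion> b \<squnion> ?u"
    unfolding b' using assms by (simp add: meet_join_sandwich)
  finally have "b \<sqsupseteq> ?u"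
    by (metis nat_ge_join_sandwich)
  have u: "?u \<in> C"
    using assms AC.meet_lower by blast
  \<comment> \<open>Since \<open>b\<close> lies below \<open>a\<close>, projecting to
    \<open>b\<close> undoes the projection to \<open>a\<close>.\<close>
  have "BC.coset ?u = BC.coset c'"
  proof (rule BC.coset_eqI[of b])
    have "b \<sqinter> ?u \<sqinter> b = (b \<sqinter> a) \<sqinter> c' \<sqinter> (a \<sqinter> b)"
      by (simp add: meet_assoc)
    then show "b \<sqinter> ?u \<sqinter> b = b \<sqinter> c' \<sqinter> b"
      using assms by (simp add: nat_ge_iff_meet)
  qed (use assms u in auto)
  also have "\<dots> = BC.coset c"
    using BC.coset_eq assms by blast
  finally have "?u \<in> BC.coset c"
    using BC.coset_refl[of b ?u] assms u by blast
  then have "?u = b \<sqinter> c \<sqinter> b"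
    using BC.coset_ge_eq[of b c ?u] assms \<open>b \<sqsupseteq> ?u\<close> by blast
  then show ?thesis
    using assms by (simp add: nat_ge_meetD)
qed

text \<open>Writing \<open>c\<close> as \<open>b1 \<sqinter> c \<sqinter> b2\<close> with factors in
  B, the outer factors from A merge into these without leaving B.\<close>

lemma coset_mono:
  assumes "b \<in> B" "c \<in> C"
  shows "AC.coset c \<subseteq> BC.coset c"
proof
  fix c' assume "c' \<in> AC.coset c"
  then obtain x y where xy: "x \<in> A" "y \<in> A" "c' = x \<sqinter> c \<sqinter> y"
    by (auto simp: AC.coset_def)
  have "c \<in> BC.coset c" using assms BC.coset_refl by blast
  then obtain b1 b2 where "b1 \<in> B" "b2 \<in> B" "c = b1 \<sqinter> c \<sqinter> b2"
    by (auto simp: BC.coset_def)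
  then have "c' = (x \<sqinter> b1) \<sqinter> c \<sqinter> (b2 \<sqinter> y)"
    using xy by (metis meet_assoc)
  then show "c' \<in> BC.coset c"
    unfolding BC.coset_def using AB.meet_lower \<open>b1 \<in> B\<close> \<open>b2 \<in> B\<close> xy by blast
qed

text \<open>The meet form of \<open>b'\<close> puts it below \<open>a'\<close> and the join form
  puts it above \<open>c'\<close>; their equality gives one element between both.\<close>

lemma between_eq:
  assumes "a \<in> A" "b \<in> B" "c \<in> C" "a \<sqsupseteq> b" "b \<sqsupseteq> c"
    and "a' \<in> A" "c' \<in> C" "a' \<sqsupseteq> c'" "a' \<in> CA.coset a" "c' \<in> AC.coset c"
  defines "b' \<equiv> a' \<sqinter> b \<sqinter> a'"
  shows "b' \<in> AB.coset b" "b' \<in> CB.coset b" "b' = c' \<squnion> b \<squnion> c'"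
proof -
  have b': "b' \<in> B" "a' \<sqsupseteq> b'"
    using assms AB.meet_lower nat_ge_meet_meet by auto
  show "b' \<in> AB.coset b"
    unfolding b'_def AB.coset_def using assms by blast
  have "a \<sqsupseteq> c"
    using assms nat_ge_trans by blast
  then have a: "c \<squnion> a' \<squnion> c = a" and c: "a \<sqinter> c' \<sqinter> a = c"
    using CA.coset_meet_eq[of c a a'] AC.coset_meet_eq[of a c c'] assms
    by (simp_all add: nat_ge_meetD nat_ge_joinD)
  \<comment> \<open>Because \<open>b\<close> is above \<open>c\<close>, distributivity turns the
    left side into the projection of \<open>b\<close> to
    \<open>c \<squnion> a' \<squnion> c = a\<close>, which is \<open>b\<close>.\<close>
  have "c \<squnion> b' \<squnion> c = c \<squnion> b \<squnion> c"
    unfolding b'_def using assms a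
    by (simp add: join_meet_sandwich nat_ge_meetD nat_ge_joinD)
  then have "CB.coset b' = CB.coset b"
    using CB.coset_eqI[of c b b'] assms b' by blast
  then show "b' \<in> CB.coset b"
    using CB.coset_refl[of c b'] assms b' by blast
  let ?b = "c' \<squnion> b \<squnion> c'"
  \<comment> \<open>Replacing \<open>b\<close> by \<open>b'\<close>, which lies below
    \<open>a'\<close>, makes \<open>meet_join_sandwich\<close> applicable at
    \<open>a'\<close>.\<close>
  have b: "?b = c' \<squnion> b' \<squnion> c'"
    using CB.coset_meet_eq[of c' b b'] \<open>b' \<in> CB.coset b\<close> assms by simp
  have "?b \<in> B"
    using assms BC.join_upper by blast
  have "a \<sqinter> ?b \<sqinter> a = c \<squnion> b \<squnion> c"
    using assms c by (simp add: meet_join_sandwich)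
  then have "a \<sqinter> ?b \<sqinter> a = a \<sqinter> b \<sqinter> a"
    using assms by (simp add: nat_ge_meetD nat_ge_joinD)
  then have "?b \<in> AB.coset b"
    using AB.coset_eqI[of a b ?b] AB.coset_refl[of a ?b] assms \<open>?b \<in> B\<close> by blast
  \<comment> \<open>The projection of \<open>?b\<close> to \<open>a'\<close> is computed twice: by
    its A-coset it is \<open>b'\<close>, by distributivity it is \<open>?b\<close>.\<close>
  then have "b' = a' \<sqinter> ?b \<sqinter> a'"
    using AB.coset_meet_eq[of a' b ?b] assms by simp
  also have "\<dots> = (a' \<sqinter> c' \<sqinter> a') \<squnion> b' \<squnion> (a' \<sqinter> c' \<sqinter> a')"
    unfolding b by (rule meet_join_sandwich[OF b'(2)])
  also have "\<dots> = ?b"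
    using assms b by (simp add: nat_ge_meetD)
  finally show "b' = ?b" .
qed

interpretation dual: distributive_class_chain "(\<sqinter>)" "(\<squnion>)" C B A
  by (rule distributive_class_chain_dual)

text \<open>With all cosets based at one chain, the left side is membership in the composite and the
  right side is the coset bijection through \<open>a\<close> and \<open>c\<close>, up to
  strictness.\<close>

lemma chain_in_coset_iff:
  assumes "a \<in> A" "b \<in> B" "c \<in> C" "a \<sqsupseteq> b" "b \<sqsupseteq> c"
  shows "(\<exists>b'. a' \<in> BA.coset a \<and> b' \<in> AB.coset b \<and> a' \<sqsupseteq> b' \<and>
            b' \<in> CB.coset b \<and> c' \<in> BC.coset c \<and> b' \<sqsupseteq> c') \<longleftrightarrow>
         a' \<in> CA.coset a \<and> c' \<in> AC.coset c \<and> a' \<sqsupseteq> c'" (is "?L \<longleftrightarrow> ?R")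
proof
  assume ?L
  then obtain b' where b': "a' \<in> BA.coset a" "b' \<in> AB.coset b" "a' \<sqsupseteq> b'"
    "b' \<in> CB.coset b" "c' \<in> BC.coset c" "b' \<sqsupseteq> c'" by blast
  have mem: "a' \<in> A" "b' \<in> B" "c' \<in> C"
    using b' assms BA.coset_subset AB.coset_subset BC.coset_subset by blast+
  have "a \<sqsupseteq> c" "a' \<sqsupseteq> c'"
    using assms b' nat_ge_trans by blast+
  have "a \<sqinter> c' \<sqinter> a = c"
    using coset_bottom[OF assms, of b' c'] mem b' by blast
  then have "c' \<in> AC.coset c"
    using AC.coset_eqI[of a c c'] AC.coset_refl[of a c'] assms mem \<open>a \<sqsupseteq> c\<close>
    by (simp add: nat_ge_meetD)
  have "c \<squnion> a' \<squnion> c = a"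
    using dual.coset_bottom[of c b a b' a'] assms mem b' by (simp add: nat_ge_dual)
  then have "a' \<in> CA.coset a"
    using CA.coset_eqI[of c a a'] CA.coset_refl[of c a'] assms mem \<open>a \<sqsupseteq> c\<close>
    by (simp add: nat_ge_joinD)
  then show ?R
    using \<open>c' \<in> AC.coset c\<close> \<open>a' \<sqsupseteq> c'\<close> by blast
next
  assume R: ?R
  then have mem: "a' \<in> A" "c' \<in> C"
    using assms CA.coset_subset AC.coset_subset by blast+
  let ?b = "a' \<sqinter> b \<sqinter> a'"
  have "?b \<in> AB.coset b" "?b \<in> CB.coset b" "?b = c' \<squnion> b \<squnion> c'"
    using between_eq[OF assms mem] R by blast+
  moreover have "a' \<sqsupseteq> ?b"
    by (rule nat_ge_meet_meet)
  moreover have "?b \<sqsupseteq> c'"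
    using \<open>?b = c' \<squnion> b \<squnion> c'\<close> nat_ge_join_join by metis
  moreover have "a' \<in> BA.coset a" "c' \<in> BC.coset c"
    using R assms coset_mono dual.coset_mono by blast+
  ultimately show ?L by blast
qed

end

section \<open>From D-classes to class pairs\<close>

context skew_lattice
begin

lemma D_class_related: "A \<in> D_classes \<Longrightarrow> x \<in> A \<Longrightarrow> y \<in> A \<longleftrightarrow> (x, y) \<in> D_rel"
  unfolding D_classes_def using quotient_eq_iff[OF equiv_D_rel]
  by (metis UNIV_I equiv_D_rel in_quotient_imp_closed quotient_eqI quotient_eq_iff)

lemma D_rel_iff_meet: "(x, y) \<in> D_rel \<longleftrightarrow> x \<sqinter> y \<sqinter> x = x \<and> y \<sqinter> x \<sqinter> y = y"
  by (auto simp: D_rel_def nat_preorder_iff_meet)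

lemma D_rel_iff_join: "(x, y) \<in> D_rel \<longleftrightarrow> x \<squnion> y \<squnion> x = x \<and> y \<squnion> x \<squnion> y = y"
  by (auto simp: D_rel_def nat_preorder_def)

lemma nat_preorder_D_rel:
  assumes "x \<succeq> y"
  shows "(y, x \<sqinter> y) \<in> D_rel" "(y, y \<sqinter> x) \<in> D_rel" "(x, x \<squnion> y) \<in> D_rel" "(x, y \<squnion> x) \<in> D_rel"
proof -
  have "y \<sqinter> x \<sqinter> y = y" using assms by (simp add: nat_preorder_iff_meet)
  then show "(y, x \<sqinter> y) \<in> D_rel" "(y, y \<sqinter> x) \<in> D_rel"
    unfolding D_rel_iff_meet by (metis meet_assoc meet_idem)+
  have "x \<squnion> y \<squnion> x = x" using assms by (simp add: nat_preorder_def)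
  then show "(x, x \<squnion> y) \<in> D_rel" "(x, y \<squnion> x) \<in> D_rel"
    unfolding D_rel_iff_join by (metis join_assoc join_idem)+
qed

lemma class_pairI:
  assumes "A \<in> D_classes" "B \<in> D_classes"
    and ge: "\<And>a b. a \<in> A \<Longrightarrow> b \<in> B \<Longrightarrow> a \<succeq> b"
  shows "class_pair (\<squnion>) (\<sqinter>) A B"
proof
  have D: "x \<succeq> y" if "x \<in> S" "y \<in> S" "S \<in> D_classes" for x y S
    using that D_class_related unfolding D_rel_def by blast
  have mem: "y \<in> S" if "S \<in> D_classes" "x \<in> S" "(x, y) \<in> D_rel" for x y S
    using that D_class_related by blast
  show "a \<sqinter> a' \<in> A" "a \<sqinter> a' \<sqinter> a = a" if "a \<in> A" "a' \<in> A" for a a'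
  proof -
    have "a \<succeq> a'" "a' \<succeq> a" using D that assms(1) by blast+
    then show "a \<sqinter> a' \<in> A" "a \<sqinter> a' \<sqinter> a = a"
      using mem[OF assms(1)] that nat_preorder_D_rel nat_preorder_iff_meet by metis+
  qed
  show "b \<squnion> b' \<in> B" "b \<squnion> b' \<squnion> b = b" if "b \<in> B" "b' \<in> B" for b b'
  proof -
    have "b \<succeq> b'" "b' \<succeq> b" using D that assms(2) by blast+
    then show "b \<squnion> b' \<in> B" "b \<squnion> b' \<squnion> b = b"
      using mem[OF assms(2)] that nat_preorder_D_rel nat_preorder_def by metis+
  qed
  show "a \<sqinter> b \<in> B" "b \<sqinter> a \<in> B" "a \<squnion> b \<in> A" "b \<squnion> a \<in> A" if "a \<in> A" "b \<in> B" for a b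
    using ge[OF that] mem[OF assms(1)] mem[OF assms(2)] that nat_preorder_D_rel by metis+
qed

lemma D_gt_nat_preorder:
  assumes "A \<in> D_classes" "B \<in> D_classes" "D_gt A B" "a \<in> A" "b \<in> B"
  shows "a \<succeq> b"
proof -
  \<comment> \<open>Reflexivity places \<open>a \<sqinter> b\<close> in the union defining
    \<open>D_meet A B\<close>, which is B.\<close>
  have "(a \<sqinter> b, a \<sqinter> b) \<in> D_rel"
    by (simp add: D_rel_iff_meet meet_idem)
  then have "a \<sqinter> b \<in> B"
    using assms unfolding D_gt_def D_meet_def by blast
  then have "b \<sqinter> (a \<sqinter> b) \<sqinter> b = b"
    using assms D_class_related D_rel_iff_meet by blast
  then show ?thesis
    by (simp add: nat_preorder_iff_meet meet_assoc meet_idem)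
qed

lemma D_classes_disjoint: "A \<in> D_classes \<Longrightarrow> B \<in> D_classes \<Longrightarrow> A \<noteq> B \<Longrightarrow> A \<inter> B = {}"
  unfolding D_classes_def using quotient_disj[OF equiv_D_rel] by blast

end

section \<open>Categoricity\<close>

context distributive_skew_lattice
begin

lemma categorical: categorical
  unfolding categorical_def
proof (intro ballI impI)
  fix A B C \<phi> \<psi>
  assume cls: "A \<in> D_classes" "B \<in> D_classes" "C \<in> D_classes"
    and gt: "D_gt A B" "D_gt B C"
    and \<phi>: "\<phi> \<in> coset_bijections A B" and \<psi>: "\<psi> \<in> coset_bijections B C"
    and ne: "\<phi> O \<psi> \<noteq> {}"
  have ge: "a \<succeq> b" "b \<succeq> c" if "a \<in> A" "b \<in> B" "c \<in> C" for a b c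
    using that cls gt D_gt_nat_preorder by blast+
  from \<phi> obtain a0 b0 where \<phi>_eq: "a0 \<in> A" "b0 \<in> B"
    "\<phi> = {(a, b) \<in> {b \<squnion> a0 \<squnion> b' | b b'. b \<in> B \<and> b' \<in> B} \<times>
                   {a \<sqinter> b0 \<sqinter> a' | a a'. a \<in> A \<and> a' \<in> A}. a \<sqsupset> b}"
    unfolding coset_bijections_def upper_cosets_def lower_cosets_def by blast
  from \<psi> obtain b1 c0 where \<psi>_eq: "b1 \<in> B" "c0 \<in> C"
    "\<psi> = {(a, b) \<in> {b \<squnion> b1 \<squnion> b' | b b'. b \<in> C \<and> b' \<in> C} \<times>
                   {a \<sqinter> c0 \<sqinter> a' | a a'. a \<in> B \<and> a' \<in> B}. a \<sqsupset> b}"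
    unfolding coset_bijections_def upper_cosets_def lower_cosets_def by blast
  have "a \<succeq> c" if "a \<in> A" "c \<in> C" for a c
    using ge \<phi>_eq(2) that nat_preorder_trans by blast
  then have pairs: "class_pair (\<squnion>) (\<sqinter>) A B" "class_pair (\<squnion>) (\<sqinter>) B C"
      "class_pair (\<squnion>) (\<sqinter>) A C"
    using cls ge \<phi>_eq(1) \<psi>_eq(2) by (simp_all add: class_pairI)
  interpret distributive_class_chain "(\<squnion>)" "(\<sqinter>)" A B C
    by (intro distributive_class_chain.intro distributive_class_chain_axioms.intro pairs
      distributive_skew_lattice_axioms)
  note coset_defs = AB.coset_def BA.coset_def BC.coset_def CB.coset_def AC.coset_def CA.coset_def
  have \<phi>_coset: "\<phi> = {(a, b) \<in> BA.coset a0 \<times> AB.coset b0. a \<sqsupset> b}"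
    and \<psi>_coset: "\<psi> = {(b, c) \<in> CB.coset b1 \<times> BC.coset c0. b \<sqsupset> c}"
    unfolding \<phi>_eq(3) \<psi>_eq(3) coset_defs by (rule refl)+
  from ne obtain a b c where "(a, b) \<in> \<phi>" "(b, c) \<in> \<psi>" by blast
  then have abc: "a \<in> BA.coset a0" "b \<in> AB.coset b0" "b \<in> CB.coset b1" "c \<in> BC.coset c0"
    and chain: "a \<sqsupseteq> b" "b \<sqsupseteq> c"
    unfolding \<phi>_coset \<psi>_coset nat_gt_def by blast+
  have mem: "a \<in> A" "b \<in> B" "c \<in> C"
    using abc \<phi>_eq \<psi>_eq BA.coset_subset AB.coset_subset BC.coset_subset by blast+
  \<comment> \<open>Nonemptiness of the composite supplies a chain at which all four cosets can be
    based.\<close>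
  have cosets: "BA.coset a0 = BA.coset a" "AB.coset b0 = AB.coset b"
    "CB.coset b1 = CB.coset b" "BC.coset c0 = BC.coset c"
    using abc mem \<phi>_eq \<psi>_eq BA.coset_eq AB.coset_eq BC.coset_eq CB.coset_eq by blast+
  \<comment> \<open>Between disjoint classes the strict and the weak order agree, so
    \<open>\<sqsupset>\<close> can be traded for \<open>\<sqsupseteq>\<close>.\<close>
  have disj: "A \<inter> B = {}" "B \<inter> C = {}"
    using cls gt D_classes_disjoint by (auto simp: D_gt_def)
  \<comment> \<open>A common element would be both above and below \<open>b\<close> in the preorder,
    which would put \<open>b\<close> into A.\<close>
  have "A \<inter> C = {}"
  proof (rule ccontr)
    assume "A \<inter> C \<noteq> {}"
    then obtain x where "x \<in> A" "x \<in> C" by blast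
    then have "(x, b) \<in> D_rel" using ge mem by (auto simp: D_rel_def)
    then have "b \<in> A" using D_class_related cls(1) \<open>x \<in> A\<close> by blast
    then show False using disj mem by blast
  qed
  have sub: "BA.coset a \<subseteq> A" "AB.coset b \<subseteq> B" "CB.coset b \<subseteq> B" "BC.coset c \<subseteq> C"
    "CA.coset a \<subseteq> A" "AC.coset c \<subseteq> C"
    using mem BA.coset_subset AB.coset_subset BC.coset_subset CB.coset_subset
      CA.coset_subset AC.coset_subset by blast+
  have "\<phi> = {(x, y). x \<in> BA.coset a \<and> y \<in> AB.coset b \<and> x \<sqsupseteq> y}"
    "\<psi> = {(y, z). y \<in> CB.coset b \<and> z \<in> BC.coset c \<and> y \<sqsupseteq> z}"
    unfolding \<phi>_coset \<psi>_coset nat_gt_def cosets using sub disj by blast+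
  then have "\<phi> O \<psi> = {(x, z). \<exists>y. x \<in> BA.coset a \<and> y \<in> AB.coset b \<and> x \<sqsupseteq> y \<and>
      y \<in> CB.coset b \<and> z \<in> BC.coset c \<and> y \<sqsupseteq> z}"
    by blast
  also have "\<dots> = {(x, z). x \<in> CA.coset a \<and> z \<in> AC.coset c \<and> x \<sqsupseteq> z}"
    using chain_in_coset_iff[OF mem chain] by presburger
  also have "\<dots> = {(x, z) \<in> CA.coset a \<times> AC.coset c. x \<sqsupset> z}"
    unfolding nat_gt_def using sub \<open>A \<inter> C = {}\<close> by blast
  also have "\<dots> \<in> coset_bijections A C"
    unfolding coset_bijections_def upper_cosets_def lower_cosets_def coset_defs
    using mem by blast
  finally show "\<phi> O \<psi> \<in> coset_bijections A C" .
qed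

end

theorem corollary2p6:
  fixes join meet :: "'a \<Rightarrow> 'a \<Rightarrow> 'a"
  assumes "distributive_skew_lattice join meet"
  shows "skew_lattice.categorical join meet"
  using assms by (rule distributive_skew_lattice.categorical)

end
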